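(* In the payment network creation game with $n$ players, betweenness weight $b\ge 0$ and closeness weight $c>0$, the social optimum is a complete graph for $c>\frac12+b$, a star graph for $b\le c\le \frac12+b$, and a path graph for $c<b$. That is, the minimum social cost $\min_s \mathrm{cost}(s)$ over all strategy combinations $s$ is attained by a strategy combination $s$ in which no channel is opened by both endpoints and whose graph $G[s]$ is the complete graph, the star graph, or the path graph on the $n$ players, respectively, in these three parameter ranges.
   Context: Payment network creation game. There are $n$ players $[n]=\{0,1,\dots,n-1\}$. A strategy of player $u$ is a set $s_u\subseteq [n]\setminus\{u\}$ (the players to whom $u$ opens a channel). A strategy combination is $s=(s_0,\dots,s_{n-1})$, and $G[s]$ is the undirected simple graph on $[n]$ in which $u,v$ are adjacent iff $v\in s_u$ or $u\in s_v$. With weights $b\ge 0$ and $c>0$, the cost of $u$ is $$\mathrm{cost}_u(s)=|s_u|+b\cdot \mathrm{betweenness}_u(s)+c\cdot \mathrm{closeness}_u(s),$$ $$\mathrm{betweenness}_u(s)=(n-1)(n-2)-\sum_{\substack{(i,j)\in[n]^2:\ i\ne j,\ i\neq u,\ j\ne u,\\ m(i,j)>0}}\frac{m_u(i,j)}{m(i,j)},\qquad \mathrm{closeness}_u(s)=\sum_{v\in[n]\setminus\{u\}}\bigl(d_{G[s]}(u,v)-1\bigr).$$ The sum in the betweenness runs over ordered pairs; $m(i,j)$ is the number of shortest paths between $i$ and $j$ in $G[s]$ and $m_u(i,j)$ the number of those passing through $u$; $d_{G[s]}$ is graph distance, equal to $\infty$ between different components (so costs are infinite if $G[s]$ is disconnected).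 The social cost is $\mathrm{cost}(s)=\sum_{u\in[n]}\mathrm{cost}_u(s)$ and the social optimum is $\min_s \mathrm{cost}(s)$. *)

theory Defs
  imports Complex_Main "HOL-Library.FuncSet" "HOL-Library.Extended_Real"
    "Graph_Theory.Graph_Theory"
begin

definition strategy_combinations :: "nat \<Rightarrow> (nat \<Rightarrow> nat set) set" where
  "strategy_combinations n = (\<Pi>\<^sub>E u\<in>{..<n}. Pow ({..<n} - {u}))"

text \<open>Undirected simple graphs are symmetric loop-free digraphs, as in the Graph_Theory entry.
  An undirected path with a choice of start vertex corresponds to exactly one arc walk, so
  counting shortest paths from i to j is not affected by this encoding.\<close>

definition network :: "nat \<Rightarrow> (nat \<Rightarrow> nat set) \<Rightarrow> nat pair_pre_digraph" where
  "network n s =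
    \<lparr> pverts = {..<n},
      parcs = {(u, v). u < n \<and> v < n \<and> u \<noteq> v \<and> (v \<in> s u \<or> u \<in> s v)} \<rparr>"

lemma pair_graph_network: "pair_graph (network n s)"
proof -
  have "finite (parcs (network n s))"
    by (rule finite_subset[of _ "{..<n} \<times> {..<n}"]) (auto simp: network_def)
  then show ?thesis
    by unfold_locales (auto simp: network_def symmetric_def intro!: symI)
qed

definition graph_dist :: "nat pair_pre_digraph \<Rightarrow> nat \<Rightarrow> nat \<Rightarrow> ereal" where
  "graph_dist G u v = wf_digraph.\<mu> (with_proj G) (\<lambda>_. 1) u v"

definition shortest_paths :: "nat pair_pre_digraph \<Rightarrow> nat \<Rightarrow> nat \<Rightarrow> (nat \<times> nat) awalk set" where
  "shortest_paths G i j =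
    {p. pre_digraph.apath (with_proj G) i p j \<and> ereal (real (length p)) = graph_dist G i j}"

definition num_shortest :: "nat pair_pre_digraph \<Rightarrow> nat \<Rightarrow> nat \<Rightarrow> nat" where
  "num_shortest G i j = card (shortest_paths G i j)"

definition num_shortest_via :: "nat pair_pre_digraph \<Rightarrow> nat \<Rightarrow> nat \<Rightarrow> nat \<Rightarrow> nat" where
  "num_shortest_via G u i j =
    card {p \<in> shortest_paths G i j. u \<in> set (pre_digraph.awalk_verts (with_proj G) i p)}"

definition betweenness_cost :: "nat \<Rightarrow> (nat \<Rightarrow> nat set) \<Rightarrow> nat \<Rightarrow> real" where
  "betweenness_cost n s u = (real n - 1) * (real n - 2) -
    (\<Sum>(i, j) \<in> {(i, j). i < n \<and> j < n \<and> i \<noteq> j \<and> i \<noteq> u \<and> j \<noteq> u \<and>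
                         num_shortest (network n s) i j > 0}.
       real (num_shortest_via (network n s) u i j) / real (num_shortest (network n s) i j))"

definition closeness_cost :: "nat \<Rightarrow> (nat \<Rightarrow> nat set) \<Rightarrow> nat \<Rightarrow> ereal" where
  "closeness_cost n s u = (\<Sum>v \<in> {..<n} - {u}. graph_dist (network n s) u v - 1)"

definition player_cost :: "nat \<Rightarrow> real \<Rightarrow> real \<Rightarrow> (nat \<Rightarrow> nat set) \<Rightarrow> nat \<Rightarrow> ereal" where
  "player_cost n b c s u =
    ereal (real (card (s u))) + ereal (b * betweenness_cost n s u) + ereal c * closeness_cost n s u"

definition social_cost :: "nat \<Rightarrow> real \<Rightarrow> real \<Rightarrow> (nat \<Rightarrow> nat set) \<Rightarrow> ereal" where
  "social_cost n b c s = (\<Sum>u<n. player_cost n b c s u)"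

lemma finite_strategy_combinations: "finite (strategy_combinations n)"
  unfolding strategy_combinations_def by (intro finite_PiE) auto

lemma strategy_combinations_nonempty: "strategy_combinations n \<noteq> {}"
  unfolding strategy_combinations_def by (auto simp: PiE_eq_empty_iff)

text \<open>The two preceding lemmas ensure that \<open>Min\<close> is a genuine minimum here.\<close>

definition social_optimum :: "nat \<Rightarrow> real \<Rightarrow> real \<Rightarrow> ereal" where
  "social_optimum n b c = Min (social_cost n b c ` strategy_combinations n)"

definition attains_social_optimum :: "nat \<Rightarrow> real \<Rightarrow> real \<Rightarrow> (nat \<Rightarrow> nat set) \<Rightarrow> bool" where
  "attains_social_optimum n b c s \<longleftrightarrow>
    s \<in> strategy_combinations n \<and> social_cost n b c s = social_optimum n b c"

definition no_double_channel :: "nat \<Rightarrow> (nat \<Rightarrow> nat set) \<Rightarrow> bool" where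
  "no_double_channel n s \<longleftrightarrow> (\<forall>u<n. \<forall>v<n. \<not> (v \<in> s u \<and> u \<in> s v))"

definition is_complete_graph :: "nat \<Rightarrow> nat pair_pre_digraph \<Rightarrow> bool" where
  "is_complete_graph n G \<longleftrightarrow> complete_digraph n (with_proj G)"

text \<open>The star on n vertices is the complete bipartite graph with parts of size 1 and n - 1;
  this is meaningful for n at least 1 only.\<close>

definition is_star_graph :: "nat \<Rightarrow> nat pair_pre_digraph \<Rightarrow> bool" where
  "is_star_graph n G \<longleftrightarrow> complete_bipartite_digraph 1 (n - 1) (with_proj G)"

definition path_graph :: "nat \<Rightarrow> nat pair_pre_digraph" where
  "path_graph n =
    \<lparr> pverts = {..<n}, parcs = {(i, j). i < n \<and> j < n \<and> (j = Suc i \<or> i = Suc j)} \<rparr>"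

definition is_path_graph :: "nat \<Rightarrow> nat pair_pre_digraph \<Rightarrow> bool" where
  "is_path_graph n G \<longleftrightarrow> digraph_iso (with_proj G) (with_proj (path_graph n))"

end

theory Submission
  imports Defs
begin

text \<open>
  In a connected network every shortest path from i to j has d(i,j) - 1 inner vertices, so summing
  the betweenness over all players gives a constant minus T, where T is the sum of d(i,j) - 1 over
  ordered pairs, and the closeness sums to T. Hence the social cost is the number of channels plus a
  constant plus (c - b) T. With m edges, T \<ge> n (n - 1) - 2 m, with equality iff the diameter is at
  most 2; for c \<ge> b this leaves a function affine in m, minimised by the most edges (complete graph)
  or the fewest, n - 1 (star). For c < b one wants few edges and large distances, and the
  path simultaneously minimises the former and maximises the latter.
\<close>

section \<open>Total distance in a connected graph\<close>

text \<open>Remove an element of largest value: the values 1 up to that maximum all occur, so the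
  maximum is at most \<open>card S\<close>, and induction gives the bound 1 + 2 + ... +
  \<open>card S\<close>. It is applied to distances from a fixed vertex.\<close>

lemma sum_le_if_levels_filled:
  fixes f :: "'a \<Rightarrow> nat"
  assumes "finite S" and "\<And>x k. x \<in> S \<Longrightarrow> 1 \<le> k \<Longrightarrow> k \<le> f x \<Longrightarrow> k \<in> f ` S"
  shows "2 * sum f S \<le> card S * (card S + 1)"
  using assms
proof (induction "card S" arbitrary: S)
  case 0
  then show ?case by simp
next
  case (Suc m)
  have "S \<noteq> {}" using Suc.hyps(2) by auto
  then have "Max (f ` S) \<in> f ` S" using Suc.prems(1) by simp
  then obtain x where "x \<in> S" "f x = Max (f ` S)" by force
  then have x: "x \<in> S" "\<And>y. y \<in> S \<Longrightarrow> f y \<le> f x" using Suc.prems(1) by simp_all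
  have "{1..f x} \<subseteq> f ` S" using Suc.prems(2) x(1) by auto
  then have "card {1..f x} \<le> card (f ` S)" using Suc.prems(1) by (intro card_mono) auto
  then have fx: "f x \<le> Suc m"
    using card_image_le[OF Suc.prems(1), of f] Suc.hyps(2) by simp
  have m: "m = card (S - {x})" using Suc.hyps(2) Suc.prems(1) x(1) by simp
  \<comment> \<open>Removing \<open>x\<close> opens no gap: either \<open>y\<close> itself takes the
    value \<open>k\<close>, or \<open>k < f x\<close> and the element taking it is not
    \<open>x\<close>.\<close>
  have "k \<in> f ` (S - {x})" if y: "y \<in> S - {x}" "1 \<le> k" "k \<le> f y" for y k
  proof (cases "k = f y")
    case True
    then show ?thesis using y by blast
  next
    case False
    then have "k < f x" using y x(2)[of y] by auto
    then show ?thesis using Suc.prems(2)[of y k] y by auto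
  qed
  then have "2 * sum f (S - {x}) \<le> m * (m + 1)"
    using Suc.hyps(1)[OF m] Suc.prems(1) m by auto
  moreover have "sum f S = f x + sum f (S - {x})" using x Suc.prems(1) by (simp add: sum.remove)
  ultimately show ?case using fx Suc.hyps(2)[symmetric] by (simp add: algebra_simps)
qed

lemma card_offdiag:
  assumes "finite V"
  shows "card (V \<times> V - Id) = card V * card V - card V"
proof -
  have "V \<times> V - Id = V \<times> V - (\<lambda>x. (x, x)) ` V" by auto
  moreover have "card ((\<lambda>x. (x, x)) ` V) = card V" by (intro card_image) (auto simp: inj_on_def)
  ultimately show ?thesis
    using assms by simp (subst card_Diff_subset, auto simp: card_cartesian_product)
qed

text \<open>Distances are natural numbers, so connectedness is built in. With \<open>d_step\<close>
  (a geodesic has a first step), \<open>d\<close> is the graph metric of the pairs at distance 1,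
  and the counting below needs no walks.\<close>

locale hop_metric =
  fixes V :: "'a set" and d :: "'a \<Rightarrow> 'a \<Rightarrow> nat"
  assumes finite_V: "finite V"
    and d_zero: "\<And>x y. x \<in> V \<Longrightarrow> y \<in> V \<Longrightarrow> d x y = 0 \<longleftrightarrow> x = y"
    and d_sym: "\<And>x y. x \<in> V \<Longrightarrow> y \<in> V \<Longrightarrow> d x y = d y x"
    and d_triangle: "\<And>x y z. x \<in> V \<Longrightarrow> y \<in> V \<Longrightarrow> z \<in> V \<Longrightarrow> d x z \<le> d x y + d y z"
    and d_step: "\<And>x y k. x \<in> V \<Longrightarrow> y \<in> V \<Longrightarrow> d x y = Suc k \<Longrightarrow> \<exists>z\<in>V. d x z = 1 \<and> d z y = k"
begin

text \<open>Ordered pairs: an undirected edge counts twice, matching the symmetric arcs of a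
  network.\<close>

definition edges :: "('a \<times> 'a) set" where
  "edges = {(x, y). x \<in> V \<and> y \<in> V \<and> d x y = 1}"

lemma edges_subset: "edges \<subseteq> V \<times> V - Id"
  using d_zero by (force simp: edges_def)

lemma finite_edges: "finite edges"
  using edges_subset finite_V by (meson finite_Diff finite_SigmaI finite_subset)

lemma card_edges_le: "card edges \<le> card V * card V - card V"
  using card_mono[OF _ edges_subset] finite_V card_offdiag[OF finite_V] by auto

text \<open>Take a vertex outside \<open>S\<close> closest to some \<open>r\<close> in
  \<open>S\<close>. The first step of a geodesic towards \<open>r\<close> is closer still, hence
  lies in \<open>S\<close>.\<close>

lemma boundary_edge:
  assumes "S \<subseteq> V" "S \<noteq> {}" "S \<noteq> V"
  obtains x y where "x \<in> S" "y \<in> V - S" "d y x = 1"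
proof -
  obtain r where r: "r \<in> S" using assms by auto
  define y where "y = arg_min (\<lambda>y. d y r) (\<lambda>y. y \<in> V - S)"
  obtain y0 where "y0 \<in> V - S" using assms by auto
  then have y: "y \<in> V - S" and ymin: "\<And>z. z \<in> V - S \<Longrightarrow> d y r \<le> d z r"
    unfolding y_def using arg_min_nat_lemma[of "\<lambda>y. y \<in> V - S" _ "\<lambda>y. d y r"] by blast+
  have "d y r \<noteq> 0" using y r assms d_zero by auto
  then obtain k where k: "d y r = Suc k" by (auto simp: gr0_conv_Suc)
  then obtain z where z: "z \<in> V" "d y z = 1" "d z r = k" using d_step y r assms(1) by blast
  then have "z \<in> S" using ymin[of z] k by force
  then show ?thesis using that y z by blast
qed

text \<open>The vertices can be listed so that each new one has a neighbour among the earlier ones,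
  as when growing a spanning tree; \<open>boundary_edge\<close> supplies the next vertex.\<close>

lemma connected_induct [consumes 1, case_names singleton insert]:
  assumes "V \<noteq> {}"
    and single: "\<And>r. r \<in> V \<Longrightarrow> P {r}"
    and step: "\<And>S x y. S \<subseteq> V \<Longrightarrow> P S \<Longrightarrow> x \<in> S \<Longrightarrow> y \<in> V \<Longrightarrow> y \<notin> S \<Longrightarrow> d y x = 1 \<Longrightarrow> P (insert y S)"
  shows "P V"
proof -
  have "\<exists>S\<subseteq>V. card S = Suc k \<and> P S" if "Suc k \<le> card V" for k
    using that
  proof (induction k)
    case 0
    then show ?case using assms(1) single by (metis card_1_singleton_iff empty_subsetI ex_in_conv insert_subset)
  next
    case (Suc k)
    then obtain S where S: "S \<subseteq> V" "card S = Suc k" "P S" by auto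
    then have "S \<noteq> {}" "S \<noteq> V" using Suc.prems by auto
    then obtain x y where xy: "x \<in> S" "y \<in> V - S" "d y x = 1" using boundary_edge S(1) by blast
    then have "P (insert y S)" using step S by blast
    moreover have "card (insert y S) = Suc (Suc k)"
      using xy S finite_V by (simp add: finite_subset)
    ultimately show ?case using S(1) xy(2) by blast
  qed
  from this[of "card V - 1"] have "\<exists>S\<subseteq>V. card S = card V \<and> P S"
    using assms(1) finite_V by (cases "card V") auto
  then show ?thesis using card_subset_eq[OF finite_V] by blast
qed

text \<open>Distances are taken in the whole graph; along an edge they change by at most one, so on a
  connected set they skip no value.\<close>

lemma connected_bounds:
  assumes "V \<noteq> {}"
  shows "2 * card V \<le> card edges + 2 \<and>
    3 * (\<Sum>x\<in>V. \<Sum>y\<in>V. d x y) + card V \<le> card V * card V * card V"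
proof -
  \<comment> \<open>The first conjunct lets \<open>w\<close> range over all of \<open>V\<close>,
    since it is later applied to the vertex about to be added. The second is the edge count of a
    tree, doubled; the third has the path as its extremal case.\<close>
  define P where "P S \<longleftrightarrow>
      (\<forall>w\<in>V. \<forall>a\<in>S. \<forall>b\<in>S. \<forall>k. d w a \<le> k \<and> k \<le> d w b \<longrightarrow> k \<in> d w ` S) \<and>
      2 * card S \<le> card (edges \<inter> S \<times> S) + 2 \<and>
      3 * (\<Sum>x\<in>S. \<Sum>y\<in>S. d x y) + card S \<le> card S * card S * card S" for S
  from assms have "P V"
  proof (induction rule: connected_induct)
    case (singleton r)
    then show ?case by (auto simp: P_def d_zero)
  next
    case (insert S x y)
    let ?T = "insert y S"
    have fin: "finite S" and xV: "x \<in> V" using insert finite_V finite_subset by auto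
    have near: "d w y \<le> Suc (d w x)" "d w x \<le> Suc (d w y)" if "w \<in> V" for w
      using d_triangle[of w x y] d_triangle[of w y x] d_sym[of x y] that insert xV by auto
    have gap: "k \<in> d w ` S" if "w \<in> V" "a \<in> S" "b \<in> S" "d w a \<le> k" "k \<le> d w b" for w a b k
      using insert.IH[unfolded P_def, THEN conjunct1, rule_format, of w a b k] that by simp
    have 1: "k \<in> d w ` ?T" if w: "w \<in> V" and a: "a \<in> ?T" and b: "b \<in> ?T"
      and k: "d w a \<le> k" "k \<le> d w b" for w a b k
    proof (cases "k = d w y")
      case True
      then show ?thesis by blast
    next
      case False
      \<comment> \<open>Replace the new vertex by its neighbour \<open>x\<close>. This shifts a
        distance by at most one, which is harmless because \<open>k\<close> differs from
        \<open>d w y\<close>.\<close>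
      define a' b' where "a' = (if a = y then x else a)" and "b' = (if b = y then x else b)"
      have "a' \<in> S" "b' \<in> S" using a b insert by (auto simp: a'_def b'_def)
      moreover have "d w a' \<le> k" "k \<le> d w b'"
        using near[OF w] k False by (auto simp: a'_def b'_def split: if_splits)
      ultimately show ?thesis using gap w by blast
    qed
    have "d x y = 1" using insert d_sym xV by simp
    then have "insert (x, y) (insert (y, x) (edges \<inter> S \<times> S)) \<subseteq> edges \<inter> ?T \<times> ?T"
      using insert xV by (auto simp: edges_def)
    then have "card (insert (x, y) (insert (y, x) (edges \<inter> S \<times> S))) \<le> card (edges \<inter> ?T \<times> ?T)"
      by (intro card_mono finite_Int) (auto simp: finite_edges)
    moreover have "card (insert (x, y) (insert (y, x) (edges \<inter> S \<times> S))) = card (edges \<inter> S \<times> S) + 2"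
      using insert finite_edges by (subst card_insert_disjoint; auto)+
    moreover have "2 * card S \<le> card (edges \<inter> S \<times> S) + 2" using insert.IH by (simp add: P_def)
    ultimately have 2: "2 * card ?T \<le> card (edges \<inter> ?T \<times> ?T) + 2" using insert fin by simp
    \<comment> \<open>Seen from \<open>y\<close>, the distances to \<open>S\<close> start at 1 (at
      \<open>x\<close>) and skip no value. So the new row and the new column each add at most
      m(m+1)/2 for m = \<open>card S\<close>, and m^3 - m + 3m(m+1) = (m+1)^3 - (m+1).\<close>
    have "k \<in> d y ` S" if "z \<in> S" "1 \<le> k" "k \<le> d y z" for z k
      using gap[of y x z k] insert that by simp
    then have "2 * sum (d y) S \<le> card S * (card S + 1)" by (rule sum_le_if_levels_filled[OF fin])
    moreover have "(\<Sum>z\<in>S. d z y) = sum (d y) S"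
      using insert d_sym by (intro sum.cong) auto
    moreover have "d y y = 0" using d_zero insert by simp
    moreover have "3 * (\<Sum>x\<in>S. \<Sum>y\<in>S. d x y) + card S \<le> card S * card S * card S"
      using insert.IH by (simp add: P_def)
    ultimately have "3 * (\<Sum>x\<in>?T. \<Sum>y\<in>?T. d x y) + card ?T \<le> card ?T * card ?T * card ?T"
      using insert fin by (simp add: sum.distrib algebra_simps)
    with 1 2 show ?case by (auto simp: P_def)
  qed
  moreover have "edges \<inter> V \<times> V = edges" by (auto simp: edges_def)
  ultimately show ?thesis by (simp add: P_def)
qed

end

section \<open>Distance as the length of a shortest walk\<close>

text \<open>Minimising over walks rather than paths makes concatenation give the triangle inequality
  directly. The value is meaningful when \<open>v\<close> is reachable from
  \<open>u\<close>.\<close>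

definition (in pre_digraph) hop_dist :: "'a \<Rightarrow> 'a \<Rightarrow> nat" where
  "hop_dist u v = (LEAST k. \<exists>p. awalk u p v \<and> length p = k)"

context wf_digraph
begin

lemma hop_dist_le: "awalk u p v \<Longrightarrow> hop_dist u v \<le> length p"
  unfolding hop_dist_def by (rule Least_le) blast

lemma shortest_awalk:
  assumes "u \<rightarrow>\<^sup>*\<^bsub>G\<^esub> v"
  obtains p where "awalk u p v" "length p = hop_dist u v"
proof -
  obtain p where "awalk u p v" using assms reachable_awalk by blast
  then have "\<exists>p'. awalk u p' v \<and> length p' = hop_dist u v"
    unfolding hop_dist_def by (intro LeastI) blast
  then show ?thesis using that by blast
qed

lemma hop_dist_triangle:
  assumes "u \<rightarrow>\<^sup>*\<^bsub>G\<^esub> v" "v \<rightarrow>\<^sup>*\<^bsub>G\<^esub> w"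
  shows "hop_dist u w \<le> hop_dist u v + hop_dist v w"
proof -
  obtain p q where p: "awalk u p v" "length p = hop_dist u v"
    and q: "awalk v q w" "length q = hop_dist v w"
    using assms shortest_awalk by metis
  have "awalk u (p @ q) w" using p(1) q(1) by (rule awalk_appendI)
  from hop_dist_le[OF this] p(2) q(2) show ?thesis by simp
qed

lemma hop_dist_eq_0_iff:
  assumes "u \<rightarrow>\<^sup>*\<^bsub>G\<^esub> v"
  shows "hop_dist u v = 0 \<longleftrightarrow> u = v"
proof
  assume "hop_dist u v = 0"
  with assms show "u = v" by (metis shortest_awalk length_0_conv awalk_empty_ends)
next
  assume "u = v"
  then have "awalk u [] v" using assms reachable_in_verts by (simp add: awalk_Nil_iff)
  from hop_dist_le[OF this] show "hop_dist u v = 0" by simp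
qed

lemma hop_dist_eq_1_iff:
  assumes "u \<rightarrow>\<^sup>*\<^bsub>G\<^esub> v"
  shows "hop_dist u v = 1 \<longleftrightarrow> u \<noteq> v \<and> u \<rightarrow>\<^bsub>G\<^esub> v"
proof
  assume d: "hop_dist u v = 1"
  obtain p where p: "awalk u p v" "length p = 1" using shortest_awalk[OF assms] d by metis
  then obtain e where "p = [e]" by (auto simp: length_Suc_conv)
  then have "u \<rightarrow>\<^bsub>G\<^esub> v" using p(1) by (auto simp: awalk_simps intro: in_arcs_imp_in_arcs_ends)
  moreover have "u \<noteq> v" using d hop_dist_eq_0_iff[OF assms] by simp
  ultimately show "u \<noteq> v \<and> u \<rightarrow>\<^bsub>G\<^esub> v" by simp
next
  assume a: "u \<noteq> v \<and> u \<rightarrow>\<^bsub>G\<^esub> v"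
  then obtain e where "e \<in> arcs G" "tail G e = u" "head G e = v" by (auto simp: arcs_ends_conv)
  then have "awalk u [e] v" by (auto simp: awalk_simps)
  from hop_dist_le[OF this] show "hop_dist u v = 1"
    using a hop_dist_eq_0_iff[OF assms] by simp
qed

text \<open>Split off the first arc of a shortest walk. The remainder is again shortest, since a
  shorter one would shorten the whole walk. This provides \<open>d_step\<close>.\<close>

lemma hop_dist_SucD:
  assumes "u \<rightarrow>\<^sup>*\<^bsub>G\<^esub> v" and "hop_dist u v = Suc k"
  obtains w where "u \<rightarrow>\<^bsub>G\<^esub> w" "w \<rightarrow>\<^sup>*\<^bsub>G\<^esub> v" "hop_dist w v = k"
proof -
  obtain p where p: "awalk u p v" "length p = Suc k" using shortest_awalk[OF assms(1)] assms(2) by metis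
  then obtain e q where e: "p = e # q" by (cases p) auto
  then have q: "e \<in> arcs G" "u = tail G e" "awalk (head G e) q v" "length q = k"
    using p by (auto simp: awalk_simps)
  have uw: "u \<rightarrow>\<^bsub>G\<^esub> head G e" using q in_arcs_imp_in_arcs_ends by blast
  have wv: "head G e \<rightarrow>\<^sup>*\<^bsub>G\<^esub> v" using q(3) reachable_awalk by blast
  obtain r where r: "awalk (head G e) r v" "length r = hop_dist (head G e) v"
    using shortest_awalk[OF wv] by metis
  have "awalk u (e # r) v" using q r by (auto simp: awalk_simps)
  from hop_dist_le[OF this] have "Suc k \<le> Suc (hop_dist (head G e) v)" using r(2) assms(2) by simp
  moreover have "hop_dist (head G e) v \<le> k" using hop_dist_le q by blast
  ultimately show ?thesis using that uw wv by simp
qed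

text \<open>A repeated vertex would give a nonempty closed subwalk, and cutting it out leaves a
  shorter walk.\<close>

lemma shortest_awalk_imp_apath:
  assumes "awalk u p v" "length p = hop_dist u v"
  shows "apath u p v"
proof (rule ccontr)
  assume "\<not> apath u p v"
  then have "\<not> distinct (awalk_verts u p)" using assms(1) by (simp add: apath_def)
  then obtain q r s where qrs: "p = q @ r @ s" "distinct (awalk_verts u q)"
    "\<exists>w. awalk u q w \<and> awalk w r w \<and> awalk w s v" "closed_w r"
    using awalk_cyc_decompE'[OF assms(1)] by metis
  then have "awalk u (q @ s) v" by (auto intro: awalk_appendI)
  from hop_dist_le[OF this] show False using qrs(1,4) assms(2) by (cases r) (auto simp: closed_w_def)
qed

lemma awalk_cost_unit: "awalk_cost (\<lambda>_. 1) p = real (length p)"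
  by (induction p) auto

lemma \<mu>_unit_eq_hop_dist:
  assumes "u \<rightarrow>\<^sup>*\<^bsub>G\<^esub> v"
  shows "\<mu> (\<lambda>_. 1) u v = ereal (real (hop_dist u v))"
proof (rule antisym)
  obtain p where p: "awalk u p v" "length p = hop_dist u v" using shortest_awalk[OF assms] .
  from min_cost_le_walk_cost[OF p(1), of "\<lambda>_. 1"] p(2)
  show "\<mu> (\<lambda>_. 1) u v \<le> ereal (real (hop_dist u v))" by (simp add: awalk_cost_unit)
  show "ereal (real (hop_dist u v)) \<le> \<mu> (\<lambda>_. 1) u v"
    unfolding \<mu>_def by (rule INF_greatest) (auto simp: awalk_cost_unit dest: hop_dist_le)
qed

end

lemma (in sym_digraph) hop_dist_commute_le:
  assumes "u \<rightarrow>\<^sup>*\<^bsub>G\<^esub> v"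
  shows "hop_dist v u \<le> hop_dist u v"
proof -
  \<comment> \<open>Reverse a walk arc by arc, appending the opposite arc at the end.\<close>
  have "\<exists>q. awalk v q u \<and> length q = length p" if "awalk u p v" for p
    using that
  proof (induction p arbitrary: u)
    case Nil
    then show ?case by (auto simp: awalk_simps)
  next
    case (Cons e p)
    then have e: "e \<in> arcs G" "u = tail G e" "awalk (head G e) p v" by (auto simp: awalk_simps)
    then obtain q where q: "awalk v q (head G e)" "length q = length p" using Cons.IH by blast
    have "u \<rightarrow>\<^bsub>G\<^esub> head G e" using in_arcs_imp_in_arcs_ends[OF e(1)] e(2) by simp
    then have "head G e \<rightarrow>\<^bsub>G\<^esub> u" using sym_arcs by (auto simp: symmetric_def dest: symD)
    then obtain e' where "e' \<in> arcs G" "tail G e' = head G e" "head G e' = u"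
      by (auto simp: arcs_ends_conv)
    then have "awalk (head G e) [e'] u" by (auto simp: awalk_simps)
    with q show ?case by (intro exI[of _ "q @ [e']"]) (auto intro: awalk_appendI)
  qed
  moreover obtain p where "awalk u p v" "length p = hop_dist u v" using shortest_awalk[OF assms] .
  ultimately show ?thesis by (metis hop_dist_le)
qed

lemma (in sym_digraph) hop_dist_commute:
  assumes "u \<rightarrow>\<^sup>*\<^bsub>G\<^esub> v"
  shows "hop_dist u v = hop_dist v u"
  using hop_dist_commute_le[OF assms]
    hop_dist_commute_le[OF symmetric_reachable[OF sym_arcs assms]] by simp

text \<open>A shortest walk is a path, so its vertices are distinct: one more than its arcs, less
  the two endpoints.\<close>

lemma (in wf_digraph) card_inner_shortest:
  assumes "awalk u p v" "length p = hop_dist u v" "u \<noteq> v"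
  shows "card (set (awalk_verts u p) - {u, v}) = hop_dist u v - 1"
proof -
  have "distinct (awalk_verts u p)" using shortest_awalk_imp_apath[OF assms(1,2)] by (simp add: apath_def)
  then have "card (set (awalk_verts u p)) = Suc (hop_dist u v)"
    using assms(2) by (simp add: distinct_card length_awalk_verts)
  moreover have "u \<in> set (awalk_verts u p)" using assms(1) by (rule hd_in_awalk_verts)
  moreover have "v \<in> set (awalk_verts u p)"
    using assms(1) last_in_set[OF awalk_verts_non_Nil, of u p] by (metis awalkE')
  ultimately show ?thesis using assms(3) by (simp add: card_Diff_subset)
qed

section \<open>The social cost of a connected network\<close>

context hop_metric
begin

lemma sum_offdiag: "(\<Sum>(x, y)\<in>V \<times> V - Id. d x y) = (\<Sum>x\<in>V. \<Sum>y\<in>V. d x y)"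
proof -
  have "(\<Sum>(x, y)\<in>V \<times> V - Id. d x y) = (\<Sum>(x, y)\<in>V \<times> V. d x y)"
    using finite_V d_zero by (intro sum.mono_neutral_left) force+
  then show ?thesis by (simp add: sum.cartesian_product)
qed

text \<open>For distinct vertices the summand is at least 2, with equality exactly when the distance
  is 1 or 2. The next two lemmas compare it with the constant 2.\<close>

lemma sum_offdiag_edges:
  "(\<Sum>(x, y)\<in>V \<times> V - Id. d x y + of_bool ((x, y) \<in> edges)) = (\<Sum>x\<in>V. \<Sum>y\<in>V. d x y) + card edges"
proof -
  have "(\<Sum>e\<in>V \<times> V - Id. of_bool (e \<in> edges)) = card edges"
    using edges_subset finite_V by (simp add: sum_of_bool_eq Int_absorb1)
  then show ?thesis
    unfolding sum_offdiag[symmetric] by (simp add: sum.distrib case_prod_beta')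
qed

lemma sum_dist_ge:
  "2 * (card V * card V - card V) \<le> (\<Sum>x\<in>V. \<Sum>y\<in>V. d x y) + card edges"
proof -
  have "(\<Sum>e\<in>V \<times> V - Id. 2) \<le> (\<Sum>(x, y)\<in>V \<times> V - Id. d x y + of_bool ((x, y) \<in> edges))"
  proof (rule sum_mono)
    fix e assume "e \<in> V \<times> V - Id"
    then obtain x y where e: "e = (x, y)" and "x \<in> V" "y \<in> V" "x \<noteq> y" by auto
    then have "d x y \<noteq> 0" "(x, y) \<in> edges \<longleftrightarrow> d x y = 1" using d_zero by (auto simp: edges_def)
    then show "2 \<le> (case e of (x, y) \<Rightarrow> d x y + of_bool ((x, y) \<in> edges))"
      using e by (cases "d x y = 1") auto
  qed
  then show ?thesis by (simp add: sum_offdiag_edges card_offdiag[OF finite_V])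
qed

lemma sum_dist_le_if_diam_2:
  assumes "\<And>x y. x \<in> V \<Longrightarrow> y \<in> V \<Longrightarrow> d x y \<le> 2"
  shows "(\<Sum>x\<in>V. \<Sum>y\<in>V. d x y) + card edges \<le> 2 * (card V * card V - card V)"
proof -
  have "(\<Sum>(x, y)\<in>V \<times> V - Id. d x y + of_bool ((x, y) \<in> edges)) \<le> (\<Sum>e\<in>V \<times> V - Id. 2)"
  proof (rule sum_mono)
    fix e assume "e \<in> V \<times> V - Id"
    then obtain x y where e: "e = (x, y)" and "x \<in> V" "y \<in> V" "x \<noteq> y" by auto
    then have "d x y \<le> 2" "(x, y) \<in> edges \<longleftrightarrow> d x y = 1" using assms by (auto simp: edges_def)
    then show "(case e of (x, y) \<Rightarrow> d x y + of_bool ((x, y) \<in> edges)) \<le> 2"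
      using e by (cases "d x y = 1") auto
  qed
  then show ?thesis by (simp add: sum_offdiag_edges card_offdiag[OF finite_V])
qed

end

section \<open>Networks as hop metrics, and betweenness by double counting\<close>

abbreviation net :: "nat \<Rightarrow> (nat \<Rightarrow> nat set) \<Rightarrow> (nat, nat \<times> nat) pre_digraph" where
  "net n s \<equiv> with_proj (network n s)"

abbreviation hops :: "nat \<Rightarrow> (nat \<Rightarrow> nat set) \<Rightarrow> nat \<Rightarrow> nat \<Rightarrow> nat" where
  "hops n s \<equiv> pre_digraph.hop_dist (net n s)"

lemma graph_net: "graph (net n s)"
proof -
  interpret pair_graph "network n s" by (rule pair_graph_network)
  show ?thesis by unfold_locales
qed

lemma pverts_network [simp]: "pverts (network n s) = {..<n}"
  by (simp add: network_def)

lemma net_reachable: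
  "strongly_connected (net n s) \<Longrightarrow> u < n \<Longrightarrow> v < n \<Longrightarrow> u \<rightarrow>\<^sup>*\<^bsub>net n s\<^esub> v"
  unfolding strongly_connected_def by simp

lemma hop_metric_net:
  assumes conn: "strongly_connected (net n s)"
  shows "hop_metric {..<n} (hops n s)"
proof -
  interpret N: graph "net n s" by (rule graph_net)
  note R = net_reachable[OF conn]
  show ?thesis
  proof
    fix x y assume "x \<in> {..<n}" "y \<in> {..<n}"
    then show "hops n s x y = 0 \<longleftrightarrow> x = y" using R N.hop_dist_eq_0_iff by simp
    show "hops n s x y = hops n s y x" using R N.hop_dist_commute \<open>x \<in> _\<close> \<open>y \<in> _\<close> by simp
  next
    fix x y z assume "x \<in> {..<n}" "y \<in> {..<n}" "z \<in> {..<n}"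
    then show "hops n s x z \<le> hops n s x y + hops n s y z"
      using R N.hop_dist_triangle by simp
  next
    fix x y k assume xy: "x \<in> {..<n}" "y \<in> {..<n}" and k: "hops n s x y = Suc k"
    then obtain w where w: "x \<rightarrow>\<^bsub>net n s\<^esub> w" "hops n s w y = k"
      using R[of x y] N.hop_dist_SucD[of x y k] by (metis lessThan_iff)
    have "x \<noteq> w" using w(1) N.adj_not_same by blast
    have wn: "w \<in> {..<n}" using w(1) N.adj_in_verts(2) by force
    then have "hops n s x w = 1" using N.hop_dist_eq_1_iff[OF R] xy w(1) \<open>x \<noteq> w\<close> by blast
    with w(2) wn show "\<exists>z\<in>{..<n}. hops n s x z = 1 \<and> hops n s z y = k" by blast
  qed simp
qed

lemma edges_net:
  assumes conn: "strongly_connected (net n s)"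
  shows "hop_metric.edges {..<n} (hops n s) = parcs (network n s)"
proof -
  interpret N: graph "net n s" by (rule graph_net)
  have "u \<rightarrow>\<^bsub>net n s\<^esub> v \<Longrightarrow> u \<noteq> v \<and> u < n \<and> v < n" for u v
    by (auto simp: network_def)
  then show ?thesis
    unfolding hop_metric.edges_def[OF hop_metric_net[OF conn]]
    using N.hop_dist_eq_1_iff[OF net_reachable[OF conn]] by auto
qed

lemma graph_dist_eq_hops:
  assumes "u \<rightarrow>\<^sup>*\<^bsub>net n s\<^esub> v"
  shows "graph_dist (network n s) u v = ereal (real (hops n s u v))"
proof -
  interpret N: graph "net n s" by (rule graph_net)
  show ?thesis unfolding graph_dist_def using N.\<mu>_unit_eq_hop_dist[OF assms] .
qed

text \<open>Count the pairs of a shortest path and an inner vertex of it in two ways; every shortest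
  path has the same number of inner vertices.\<close>

lemma sum_num_shortest_via:
  assumes conn: "strongly_connected (net n s)" and ij: "i < n" "j < n" "i \<noteq> j"
  shows "(\<Sum>u\<in>{..<n} - {i, j}. num_shortest_via (network n s) u i j) =
      num_shortest (network n s) i j * (hops n s i j - 1)"
    and "num_shortest (network n s) i j > 0"
proof -
  interpret N: graph "net n s" by (rule graph_net)
  let ?U = "{..<n} - {i, j}" and ?SP = "shortest_paths (network n s) i j"
  have R: "i \<rightarrow>\<^sup>*\<^bsub>net n s\<^esub> j" using net_reachable[OF conn] ij by simp
  \<comment> \<open>Shortest walks are automatically paths, so walks suffice.\<close>
  have SP: "?SP = {p. N.awalk i p j \<and> length p = hops n s i j}"
    unfolding shortest_paths_def graph_dist_eq_hops[OF R]
    using N.shortest_awalk_imp_apath N.awalkI_apath by auto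
  have "?SP \<subseteq> {p. N.apath i p j}" unfolding shortest_paths_def by auto
  then have fin: "finite ?SP" using N.apaths_finite finite_subset by blast
  have "?SP \<noteq> {}" using N.shortest_awalk[OF R] unfolding SP by blast
  with fin show "num_shortest (network n s) i j > 0" by (simp add: num_shortest_def card_gt_0_iff)
  have via: "num_shortest_via (network n s) u i j = (\<Sum>p\<in>?SP. of_bool (u \<in> set (N.awalk_verts i p)))" for u
    using fin by (simp add: num_shortest_via_def sum_of_bool_eq Collect_conj_eq Int_commute)
  have inner: "(\<Sum>u\<in>?U. of_bool (u \<in> set (N.awalk_verts i p))) = hops n s i j - 1" if "p \<in> ?SP" for p
  proof -
    have p: "N.awalk i p j" "length p = hops n s i j" using that SP by auto
    then have "set (N.awalk_verts i p) \<subseteq> {..<n}" by (metis N.awalkE' with_proj_simps(1) pverts_network)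
    then have "?U \<inter> {u. u \<in> set (N.awalk_verts i p)} = set (N.awalk_verts i p) - {i, j}" by auto
    then show ?thesis using N.card_inner_shortest[OF p ij(3)] by (simp add: sum_of_bool_eq)
  qed
  show "(\<Sum>u\<in>?U. num_shortest_via (network n s) u i j) =
      num_shortest (network n s) i j * (hops n s i j - 1)"
    unfolding via by (subst sum.swap) (simp add: inner num_shortest_def del: sum_of_bool_eq)
qed

abbreviation total_dist :: "nat \<Rightarrow> (nat \<Rightarrow> nat set) \<Rightarrow> nat" where
  "total_dist n s \<equiv> \<Sum>i<n. \<Sum>j<n. hops n s i j"

lemma sum_offdiag_hops:
  assumes conn: "strongly_connected (net n s)"
  shows "(\<Sum>(i, j)\<in>{..<n} \<times> {..<n} - Id. real (hops n s i j) - 1)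
    = real (total_dist n s) - real n * (real n - 1)"
proof -
  interpret hop_metric "{..<n}" "hops n s" by (rule hop_metric_net[OF conn])
  have "(\<Sum>(i, j)\<in>{..<n} \<times> {..<n} - Id. real (hops n s i j) - 1)
    = real (\<Sum>(i, j)\<in>{..<n} \<times> {..<n} - Id. hops n s i j) - real (card ({..<n} \<times> {..<n} - Id))"
    by (simp add: sum_subtractf case_prod_beta')
  also have "real (card ({..<n} \<times> {..<n} - Id)) = real n * (real n - 1)"
    unfolding card_offdiag[OF finite_V] by (simp add: of_nat_diff algebra_simps)
  finally show ?thesis unfolding sum_offdiag .
qed

text \<open>Exchange the sums over players and pairs. For a fixed pair, the fractions add up to the
  number of inner vertices, however many shortest paths there are.\<close>

lemma sum_betweenness_cost:
  assumes conn: "strongly_connected (net n s)"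
  shows "(\<Sum>u<n. betweenness_cost n s u) = real n * (real n - 1) * (real n - 2)
    - (real (total_dist n s) - real n * (real n - 1))"
proof -
  interpret hop_metric "{..<n}" "hops n s" by (rule hop_metric_net[OF conn])
  let ?O = "{..<n} \<times> {..<n} - Id" and ?m = "num_shortest (network n s)"
  let ?f = "\<lambda>u e. real (num_shortest_via (network n s) u (fst e) (snd e)) / real (?m (fst e) (snd e))"
  have "{(i, j). i < n \<and> j < n \<and> i \<noteq> j \<and> i \<noteq> u \<and> j \<noteq> u \<and> ?m i j > 0}
      = {e \<in> ?O. u \<notin> {fst e, snd e}}" for u
    using sum_num_shortest_via(2)[OF conn] by auto
  then have "(\<Sum>u<n. betweenness_cost n s u) = (\<Sum>u<n. (real n - 1) * (real n - 2))
      - (\<Sum>u<n. \<Sum>e\<in>{e \<in> ?O. u \<notin> {fst e, snd e}}. ?f u e)"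
    unfolding betweenness_cost_def by (simp only: sum_subtractf case_prod_beta')
  also have "(\<Sum>u<n. \<Sum>e\<in>{e \<in> ?O. u \<notin> {fst e, snd e}}. ?f u e)
      = (\<Sum>e\<in>?O. \<Sum>u\<in>{u \<in> {..<n}. u \<notin> {fst e, snd e}}. ?f u e)"
    by (intro sum.swap_restrict) auto
  also have "\<dots> = (\<Sum>(i, j)\<in>?O. real (hops n s i j) - 1)"
  proof (rule sum.cong[OF refl])
    fix e assume e: "e \<in> ?O"
    then obtain i j where ij: "e = (i, j)" "i < n" "j < n" "i \<noteq> j" by auto
    have "{u \<in> {..<n}. u \<notin> {i, j}} = {..<n} - {i, j}" by auto
    then have "(\<Sum>u\<in>{u \<in> {..<n}. u \<notin> {fst e, snd e}}. ?f u e)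
        = real (\<Sum>u\<in>{..<n} - {i, j}. num_shortest_via (network n s) u i j) / real (?m i j)"
      by (simp add: ij sum_divide_distrib)
    also have "\<dots> = real (hops n s i j - 1)"
      using sum_num_shortest_via[OF conn ij(2-4)] by simp
    \<comment> \<open>The subtraction of naturals is exact, as \<open>i \<noteq> j\<close> makes the
      distance positive.\<close>
    also have "\<dots> = real (hops n s i j) - 1"
      using d_zero[of i j] ij by (simp add: of_nat_diff)
    finally show "(\<Sum>u\<in>{u \<in> {..<n}. u \<notin> {fst e, snd e}}. ?f u e)
        = (case e of (i, j) \<Rightarrow> real (hops n s i j) - 1)" using ij by simp
  qed
  finally show ?thesis unfolding sum_offdiag_hops[OF conn] by simp
qed

text \<open>All terms are finite, so the cost is a real number, and it depends on \<open>s\<close>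
  only through the channel count and the total distance.\<close>

lemma social_cost_connected:
  assumes conn: "strongly_connected (net n s)"
  shows "social_cost n b c s = ereal (real (\<Sum>u<n. card (s u)) + b * (real n * (real n - 1) * (real n - 2))
    + (c - b) * (real (total_dist n s) - real n * (real n - 1)))"
proof -
  have "closeness_cost n s u = ereal (\<Sum>v\<in>{..<n} - {u}. real (hops n s u v) - 1)" if "u < n" for u
    unfolding closeness_cost_def using graph_dist_eq_hops[OF net_reachable[OF conn that]]
    by (simp add: one_ereal_def flip: sum_ereal)
  then have "social_cost n b c s = (\<Sum>u<n. ereal (real (card (s u)) + b * betweenness_cost n s u
      + c * (\<Sum>v\<in>{..<n} - {u}. real (hops n s u v) - 1)))"
    unfolding social_cost_def player_cost_def by (intro sum.cong) auto
  also have "\<dots> = ereal (real (\<Sum>u<n. card (s u)) + b * (\<Sum>u<n. betweenness_cost n s u)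
      + c * (\<Sum>u<n. \<Sum>v\<in>{..<n} - {u}. real (hops n s u v) - 1))"
    by (simp add: sum.distrib sum_distrib_left)
  also have "(\<Sum>u<n. \<Sum>v\<in>{..<n} - {u}. real (hops n s u v) - 1)
      = (\<Sum>(u, v)\<in>{..<n} \<times> {..<n} - Id. real (hops n s u v) - 1)"
    by (subst sum.Sigma) (auto intro!: sum.cong)
  finally show ?thesis
    unfolding sum_offdiag_hops[OF conn] sum_betweenness_cost[OF conn] by (simp add: algebra_simps)
qed

text \<open>An unreachable pair gives an infinite closeness term, and \<open>c > 0\<close> keeps its
  multiple infinite. In \<open>ereal\<close> one infinite summand makes the finite sum
  infinite.\<close>

lemma social_cost_disconnected:
  assumes "\<not> strongly_connected (net n s)" and "n \<ge> 1" and "c > 0"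
  shows "social_cost n b c s = \<infinity>"
proof -
  interpret N: graph "net n s" by (rule graph_net)
  obtain u v where uv: "u < n" "v < n" "\<not> u \<rightarrow>\<^sup>*\<^bsub>net n s\<^esub> v"
    using assms(1,2) unfolding strongly_connected_def by (auto simp: lessThan_empty_iff)
  then have "u \<noteq> v" using N.reachable_refl by fastforce
  have "graph_dist (network n s) u v = \<infinity>"
    unfolding graph_dist_def using N.shortest_path_inf uv(3) by simp
  then have "closeness_cost n s u = \<infinity>"
    unfolding closeness_cost_def sum_Pinfty using uv(2) \<open>u \<noteq> v\<close> by (intro conjI bexI[of _ v]) auto
  then have "player_cost n b c s u = \<infinity>" using assms(3) by (simp add: player_cost_def)
  then show ?thesis unfolding social_cost_def sum_Pinfty using uv(1) by auto
qed

section \<open>Channels versus arcs, and a criterion for optimality\<close>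

lemma channels_finite: "s \<in> strategy_combinations n \<Longrightarrow> u < n \<Longrightarrow> finite (s u)"
  by (auto simp: strategy_combinations_def PiE_iff intro: finite_subset[of _ "{..<n}"])

lemma parcs_network_eq:
  assumes "s \<in> strategy_combinations n"
  shows "parcs (network n s) = (SIGMA u:{..<n}. s u) \<union> (SIGMA u:{..<n}. s u)\<inverse>"
  using assms by (auto simp: network_def strategy_combinations_def PiE_iff)

text \<open>The arcs are the opened channels together with their reversals; the inequality is strict
  exactly when some channel is opened from both ends.\<close>

lemma card_parcs_le:
  assumes "s \<in> strategy_combinations n"
  shows "card (parcs (network n s)) \<le> 2 * (\<Sum>u<n. card (s u))"
proof -
  have "card (parcs (network n s)) \<le> card (SIGMA u:{..<n}. s u) + card ((SIGMA u:{..<n}. s u)\<inverse>)"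
    unfolding parcs_network_eq[OF assms] by (rule card_Un_le)
  then show ?thesis using channels_finite[OF assms] by (simp add: card_inverse)
qed

lemma card_parcs_no_double_channel:
  assumes "s \<in> strategy_combinations n" and "no_double_channel n s"
  shows "card (parcs (network n s)) = 2 * (\<Sum>u<n. card (s u))"
proof -
  have "(SIGMA u:{..<n}. s u) \<inter> (SIGMA u:{..<n}. s u)\<inverse> = {}"
    using assms(2) by (auto simp: no_double_channel_def)
  moreover have "finite (SIGMA u:{..<n}. s u)" using channels_finite[OF assms(1)] by auto
  ultimately have "card (parcs (network n s)) = card (SIGMA u:{..<n}. s u) + card ((SIGMA u:{..<n}. s u)\<inverse>)"
    unfolding parcs_network_eq[OF assms(1)] by (intro card_Un_disjoint) auto
  then show ?thesis using channels_finite[OF assms(1)] by (simp add: card_inverse)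
qed

lemma attains_social_optimumI:
  assumes "s \<in> strategy_combinations n"
    and "\<And>t. t \<in> strategy_combinations n \<Longrightarrow> social_cost n b c s \<le> social_cost n b c t"
  shows "attains_social_optimum n b c s"
proof -
  have "Min (social_cost n b c ` strategy_combinations n) = social_cost n b c s"
    by (rule Min_eqI) (use assms finite_strategy_combinations[of n] in auto)
  then show ?thesis using assms(1) by (simp add: attains_social_optimum_def social_optimum_def)
qed

text \<open>Passing repeatedly to a smaller neighbour leads to vertex 0, and symmetry joins any two
  vertices through it.\<close>

lemma strongly_connected_netI:
  assumes "n \<ge> 1" and "\<And>v. 0 < v \<Longrightarrow> v < n \<Longrightarrow> \<exists>w<v. (w, v) \<in> parcs (network n s)"
  shows "strongly_connected (net n s)"
proof -
  interpret N: graph "net n s" by (rule graph_net)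
  have R: "0 \<rightarrow>\<^sup>*\<^bsub>net n s\<^esub> v" if "v < n" for v
    using that
  proof (induction v rule: less_induct)
    case (less v)
    show ?case
    proof (cases "v = 0")
      case True
      then show ?thesis using less.prems N.reachable_refl by simp
    next
      case False
      then obtain w where w: "w < v" "(w, v) \<in> parcs (network n s)" using assms(2) less.prems by auto
      then have "0 \<rightarrow>\<^sup>*\<^bsub>net n s\<^esub> w" using less by simp
      then show ?thesis using w(2) by (metis N.reachable_adj_trans with_proj_simps(3))
    qed
  qed
  have "u \<rightarrow>\<^sup>*\<^bsub>net n s\<^esub> v" if "u < n" "v < n" for u v
    using R that N.symmetric_reachable' N.reachable_trans by meson
  then show ?thesis using assms(1) unfolding strongly_connected_def by (auto simp: lessThan_empty_iff)
qed

text \<open>\<open>A\<close> is twice the number of edges. The first bound serves the complete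
  graph, the second the star and the path, the third the path, and the last two the networks of
  diameter at most 2.\<close>

lemma hop_metric_net_bounds:
  assumes conn: "strongly_connected (net n s)" and "n \<ge> 1"
  defines "A \<equiv> card (parcs (network n s))"
  shows "real A \<le> real (n * n) - real n" "2 * real n - 2 \<le> real A"
    "3 * total_dist n s + n \<le> n * n * n"
    "2 * (real (n * n) - real n) \<le> real (total_dist n s) + real A"
    "(\<And>x y. x < n \<Longrightarrow> y < n \<Longrightarrow> hops n s x y \<le> 2) \<Longrightarrow>
      real (total_dist n s) + real A = 2 * (real (n * n) - real n)"
proof -
  interpret hop_metric "{..<n}" "hops n s" by (rule hop_metric_net[OF conn])
  note E = edges_net[OF conn]
  have "{..<n} \<noteq> {}" using assms(2) by (auto simp: lessThan_empty_iff)
  from connected_bounds[OF this] have "2 * n \<le> A + 2" by (simp add: A_def E)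
  then show "2 * real n - 2 \<le> real A" by linarith
  from connected_bounds[OF \<open>{..<n} \<noteq> {}\<close>] show "3 * total_dist n s + n \<le> n * n * n" by simp
  have nn: "real (n * n - n) = real (n * n) - real n" by (simp add: of_nat_diff)
  show "real A \<le> real (n * n) - real n"
    using card_edges_le unfolding nn[symmetric] of_nat_le_iff by (simp add: A_def E)
  have ge: "2 * (n * n - n) \<le> total_dist n s + A" using sum_dist_ge by (simp add: A_def E)
  then show "2 * (real (n * n) - real n) \<le> real (total_dist n s) + real A"
    unfolding nn[symmetric] by linarith
  assume "\<And>x y. x < n \<Longrightarrow> y < n \<Longrightarrow> hops n s x y \<le> 2"
  then have "total_dist n s + A \<le> 2 * (n * n - n)"
    using sum_dist_le_if_diam_2 by (simp add: A_def E)
  with ge show "real (total_dist n s) + real A = 2 * (real (n * n) - real n)"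
    unfolding nn[symmetric] by linarith
qed

section \<open>Optimal strategy combinations\<close>

lemma hops_le_1_if_adjacent:
  assumes conn: "strongly_connected (net n s)" and "x < n" "y < n" "x = y \<or> (x, y) \<in> parcs (network n s)"
  shows "hops n s x y \<le> 1"
proof -
  interpret hop_metric "{..<n}" "hops n s" by (rule hop_metric_net[OF conn])
  from assms(4) show ?thesis
  proof
    assume "x = y"
    then show ?thesis using d_zero[of x y] assms(2,3) by simp
  next
    assume "(x, y) \<in> parcs (network n s)"
    then have "(x, y) \<in> edges" using edges_net[OF conn] by simp
    then show ?thesis by (simp add: edges_def)
  qed
qed

lemma social_cost_le_iff:
  assumes "strongly_connected (net n s)" "strongly_connected (net n t)"
  shows "social_cost n b c s \<le> social_cost n b c t \<longleftrightarrow>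
    real (\<Sum>u<n. card (s u)) + (c - b) * real (total_dist n s)
      \<le> real (\<Sum>u<n. card (t u)) + (c - b) * real (total_dist n t)"
  unfolding social_cost_connected[OF assms(1)] social_cost_connected[OF assms(2)] ereal_less_eq right_diff_distrib
  by linarith

lemma attains_social_optimumI_connected:
  assumes "n \<ge> 1" "c > 0" "s \<in> strategy_combinations n" "strongly_connected (net n s)"
    and "\<And>t. t \<in> strategy_combinations n \<Longrightarrow> strongly_connected (net n t) \<Longrightarrow>
      real (\<Sum>u<n. card (s u)) + (c - b) * real (total_dist n s)
      \<le> real (\<Sum>u<n. card (t u)) + (c - b) * real (total_dist n t)"
  shows "attains_social_optimum n b c s"
proof (rule attains_social_optimumI[OF assms(3)])
  fix t assume t: "t \<in> strategy_combinations n"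
  show "social_cost n b c s \<le> social_cost n b c t"
  proof (cases "strongly_connected (net n t)")
    case True
    then show ?thesis using assms(4,5) t social_cost_le_iff by blast
  next
    case False
    then show ?thesis using social_cost_disconnected assms(1,2) by simp
  qed
qed

text \<open>With k = c - b, A arcs and M = 2(n^2 - n), diameter at most 2 gives total distance M - A
  and cost (1/2 - k)A + kM up to a constant. A competitor costs at least the same expression in its
  own arcs because k is nonnegative, so \<open>arcs_le\<close> decides.\<close>

lemma diam_2_optimal:
  fixes b c :: real
  assumes "n \<ge> 1" "c > 0" "b \<le> c" and strat: "s \<in> strategy_combinations n" and nd: "no_double_channel n s"
    and conn: "strongly_connected (net n s)"
    and diam: "\<And>x y. x < n \<Longrightarrow> y < n \<Longrightarrow> hops n s x y \<le> 2"
    and arcs_le: "\<And>t. strongly_connected (net n t) \<Longrightarrow>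
      (1/2 - (c - b)) * real (card (parcs (network n s))) \<le> (1/2 - (c - b)) * real (card (parcs (network n t)))"
  shows "attains_social_optimum n b c s"
proof (rule attains_social_optimumI_connected[OF assms(1,2) strat conn])
  fix t assume t: "t \<in> strategy_combinations n" and ct: "strongly_connected (net n t)"
  let ?A = "\<lambda>s. real (card (parcs (network n s)))" and ?C = "\<lambda>s. real (\<Sum>u<n. card (s u))"
  \<comment> \<open>Here \<open>W\<close>, \<open>W'\<close> are the total distances of
    \<open>s\<close> and \<open>t\<close>, \<open>A\<close>, \<open>A'\<close> their arc counts, and
    \<open>C'\<close> the channel count of \<open>t\<close>.\<close>
  have real_ineq: "A/2 + k * W \<le> C' + k * W'"
    if "0 \<le> k" "(1/2 - k) * A \<le> (1/2 - k) * A'" "A' \<le> 2 * C'" "W + A = M" "M \<le> W' + A'"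
    for k A A' C' W W' M :: real
  proof -
    have "k * (W + A) \<le> k * (W' + A')" using that by (intro mult_left_mono) auto
    with that(2,3) show ?thesis by (simp add: algebra_simps)
  qed
  have "?C s = ?A s / 2" using card_parcs_no_double_channel[OF strat nd] by simp
  moreover have "?A t \<le> 2 * ?C t" using card_parcs_le[OF t] by linarith
  moreover have "?A s / 2 + (c - b) * real (total_dist n s) \<le> ?C t + (c - b) * real (total_dist n t)"
    if "?A t \<le> 2 * ?C t"
    by (rule real_ineq[OF _ arcs_le[OF ct] that hop_metric_net_bounds(5)[OF conn assms(1) diam]
        hop_metric_net_bounds(4)[OF ct assms(1)]]) (use assms(3) in auto)
  ultimately show "?C s + (c - b) * real (total_dist n s) \<le> ?C t + (c - b) * real (total_dist n t)"
    by (simp only:)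
qed

section \<open>The complete graph\<close>

definition complete_strategy :: "nat \<Rightarrow> nat \<Rightarrow> nat set" where
  "complete_strategy n = (\<lambda>u\<in>{..<n}. {u<..<n})"

lemma complete_strategy_optimal:
  assumes "n \<ge> 1" "c > 0" "c > 1/2 + b"
  shows "attains_social_optimum n b c (complete_strategy n) \<and> no_double_channel n (complete_strategy n) \<and>
    is_complete_graph n (network n (complete_strategy n))"
proof -
  let ?s = "complete_strategy n"
  have strat: "?s \<in> strategy_combinations n"
    by (auto simp: complete_strategy_def strategy_combinations_def)
  have nd: "no_double_channel n ?s" by (auto simp: complete_strategy_def no_double_channel_def)
  have parcs: "parcs (network n ?s) = {..<n} \<times> {..<n} - Id"
    by (auto simp: complete_strategy_def network_def)
  have compl: "is_complete_graph n (network n ?s)"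
    unfolding is_complete_graph_def complete_digraph_pair_def parcs by auto
  have conn: "strongly_connected (net n ?s)"
    by (rule strongly_connected_netI[OF assms(1)]) (auto simp: parcs)
  have le2: "hops n ?s x y \<le> 2" if "x < n" "y < n" for x y
    using hops_le_1_if_adjacent[OF conn that] that parcs by fastforce
  have A: "real (card (parcs (network n ?s))) = real (n * n) - real n"
    using card_offdiag[of "{..<n}"] by (simp add: parcs of_nat_diff)
  have "attains_social_optimum n b c ?s"
  proof (rule diam_2_optimal[OF assms(1,2) _ strat nd conn le2])
    fix t assume ct: "strongly_connected (net n t)"
    \<comment> \<open>The factor is negative, so the largest possible arc count is best.\<close>
    show "(1/2 - (c - b)) * real (card (parcs (network n ?s))) \<le> (1/2 - (c - b)) * real (card (parcs (network n t)))"
      unfolding A using hop_metric_net_bounds(1)[OF ct assms(1)] assms(3) by (intro mult_left_mono_neg) auto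
  qed (use assms(3) in auto)
  with nd compl show ?thesis by blast
qed

section \<open>The star\<close>

definition star_strategy :: "nat \<Rightarrow> nat \<Rightarrow> nat set" where
  "star_strategy n = (\<lambda>u\<in>{..<n}. if u = 0 then {1..<n} else {})"

lemma star_strategy_optimal:
  assumes "n \<ge> 1" "c > 0" "b \<le> c" "c \<le> 1/2 + b"
  shows "attains_social_optimum n b c (star_strategy n) \<and> no_double_channel n (star_strategy n) \<and>
    is_star_graph n (network n (star_strategy n))"
proof -
  let ?s = "star_strategy n"
  have strat: "?s \<in> strategy_combinations n"
    using assms(1) by (auto simp: star_strategy_def strategy_combinations_def split: if_splits)
  have nd: "no_double_channel n ?s" by (auto simp: star_strategy_def no_double_channel_def)
  have parcs: "parcs (network n ?s) = {0} \<times> {1..<n} \<union> {1..<n} \<times> {0}"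
    by (auto simp: star_strategy_def network_def split: if_splits)
  have star: "is_star_graph n (network n ?s)"
    unfolding is_star_graph_def complete_bipartite_digraph_pair_def parcs
    by (rule conjI, simp, rule exI[of _ "{0}"], rule exI[of _ "{1..<n}"], use assms(1) in auto)
  have conn: "strongly_connected (net n ?s)"
    by (rule strongly_connected_netI[OF assms(1)]) (auto simp: parcs)
  interpret hop_metric "{..<n}" "hops n ?s" by (rule hop_metric_net[OF conn])
  have le2: "hops n ?s x y \<le> 2" if "x < n" "y < n" for x y
  proof -
    \<comment> \<open>Any two vertices are joined through the centre 0.\<close>
    have "hops n ?s x 0 \<le> 1" "hops n ?s 0 y \<le> 1"
      using that by (intro hops_le_1_if_adjacent[OF conn]; force simp: parcs)+
    then show ?thesis using d_triangle[of x 0 y] that by simp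
  qed
  have C: "(\<Sum>u<n. card (?s u)) = n - 1"
    using assms(1) by (subst sum.remove[of _ 0]) (auto simp: star_strategy_def)
  have A: "real (card (parcs (network n ?s))) = 2 * real n - 2"
    using card_parcs_no_double_channel[OF strat nd] C assms(1) by (simp add: of_nat_diff)
  have "attains_social_optimum n b c ?s"
  proof (rule diam_2_optimal[OF assms(1,2,3) strat nd conn le2])
    fix t assume ct: "strongly_connected (net n t)"
    \<comment> \<open>Now the factor is nonnegative, so the arc count of a tree is best.\<close>
    show "(1/2 - (c - b)) * real (card (parcs (network n ?s))) \<le> (1/2 - (c - b)) * real (card (parcs (network n t)))"
      unfolding A using hop_metric_net_bounds(2)[OF ct assms(1)] assms(4) by (intro mult_left_mono) auto
  qed
  with nd star show ?thesis by blast
qed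

section \<open>The path\<close>

definition path_strategy :: "nat \<Rightarrow> nat \<Rightarrow> nat set" where
  "path_strategy n = (\<lambda>u\<in>{..<n}. {Suc u} \<inter> {..<n})"

text \<open>With truncated subtraction the summand is |i - j|. The last row and column each add
  n(n+1)/2, so the value meets the upper bound of \<open>connected_bounds\<close> with
  equality.\<close>

lemma sum_path_dist: "3 * (\<Sum>i<n. \<Sum>j<n. (i - j) + (j - i)) + n = n * n * n" for n :: nat
proof (induction n)
  case (Suc n)
  have "2 * (\<Sum>j<n. n - j) = n * (n + 1)"
  proof (induction n)
    case (Suc n)
    have "(\<Sum>j<n. Suc n - j) = (\<Sum>j<n. 1 + (n - j))" by (intro sum.cong) auto
    then have "(\<Sum>j<Suc n. Suc n - j) = n + (\<Sum>j<n. n - j) + 1"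
      unfolding sum.lessThan_Suc sum.distrib by simp
    then show ?case using Suc by simp
  qed simp
  moreover have "(\<Sum>j<n. (n - j) + (j - n)) = (\<Sum>j<n. n - j)"
    "(\<Sum>j<n. (j - n) + (n - j)) = (\<Sum>j<n. n - j)" by (auto intro!: sum.cong)
  moreover have "(\<Sum>i<Suc n. \<Sum>j<Suc n. f i j) =
      (\<Sum>i<n. \<Sum>j<n. f i j) + (\<Sum>i<n. f i n) + ((\<Sum>j<n. f n j) + f n n)" for f :: "nat \<Rightarrow> nat \<Rightarrow> nat"
    by (simp add: sum.distrib)
  note this[of "\<lambda>i j. (i - j) + (j - i)"]
  ultimately have "(\<Sum>i<Suc n. \<Sum>j<Suc n. (i - j) + (j - i)) =
      (\<Sum>i<n. \<Sum>j<n. (i - j) + (j - i)) + n * (n + 1)" by linarith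
  with Suc have "3 * (\<Sum>i<Suc n. \<Sum>j<Suc n. (i - j) + (j - i)) + Suc n = n * n * n + 3 * (n * (n + 1)) + 1"
    by linarith
  then show ?case by (simp add: algebra_simps)
qed simp

lemma digraph_iso_refl: "wf_digraph G \<Longrightarrow> digraph_iso G G"
  unfolding digraph_iso_def
  by (intro exI[of _ "\<lparr>iso_verts = id, iso_arcs = id, iso_head = head G, iso_tail = tail G\<rparr>"])
     (simp add: pre_digraph.digraph_isomorphism_def app_iso_def)

lemma path_strategy_optimal:
  assumes "n \<ge> 1" "c > 0" "c < b"
  shows "attains_social_optimum n b c (path_strategy n) \<and> no_double_channel n (path_strategy n) \<and>
    is_path_graph n (network n (path_strategy n))"
proof -
  let ?s = "path_strategy n"
  have strat: "?s \<in> strategy_combinations n"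
    by (auto simp: path_strategy_def strategy_combinations_def)
  have nd: "no_double_channel n ?s" by (auto simp: path_strategy_def no_double_channel_def)
  have path: "network n ?s = path_graph n"
    by (auto simp: path_strategy_def network_def path_graph_def)
  interpret N: graph "net n ?s" by (rule graph_net)
  have is_path: "is_path_graph n (network n ?s)"
    unfolding is_path_graph_def path[symmetric] by (rule digraph_iso_refl) unfold_locales
  have conn: "strongly_connected (net n ?s)"
    by (rule strongly_connected_netI[OF assms(1)])
       (auto simp: path path_graph_def gr0_conv_Suc)
  interpret hop_metric "{..<n}" "hops n ?s" by (rule hop_metric_net[OF conn])
  \<comment> \<open>One hop changes the index by one, so the hop distance is at least |x - y|. This
    lower bound makes the total distance maximal.\<close>
  have dist: "(x - y) + (y - x) \<le> k" if "x < n" "y < n" "hops n ?s x y = k" for x y k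
    using that
  proof (induction k arbitrary: x)
    case 0
    then show ?case using d_zero by simp
  next
    case (Suc k)
    then obtain z where z: "z < n" "hops n ?s x z = 1" "hops n ?s z y = k"
      using d_step[of x y k] by auto
    then have "(x, z) \<in> edges" using Suc.prems(1) by (simp add: edges_def)
    then have "(x, z) \<in> parcs (network n ?s)" using edges_net[OF conn] by simp
    then have "(x, z) \<in> parcs (path_graph n)" by (simp only: path)
    then have "x = Suc z \<or> z = Suc x" by (auto simp: path_graph_def)
    then show ?case using Suc.IH[OF z(1) Suc.prems(2) z(3)] by linarith
  qed
  have C: "(\<Sum>u<n. card (?s u)) = n - 1"
  proof -
    obtain m where n: "n = Suc m" using assms(1) by (cases n) auto
    have "(\<Sum>u<m. card (?s u)) = (\<Sum>u<m. 1)" by (intro sum.cong) (auto simp: path_strategy_def n)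
    then show ?thesis by (simp add: n path_strategy_def)
  qed
  have "(\<Sum>i<n. \<Sum>j<n. (i - j) + (j - i)) \<le> total_dist n ?s"
    by (intro sum_mono dist) auto
  with sum_path_dist[of n] have W: "n * n * n \<le> 3 * total_dist n ?s + n" by linarith
  have "attains_social_optimum n b c ?s"
  proof (rule attains_social_optimumI_connected[OF assms(1,2) strat conn])
    fix t assume t: "t \<in> strategy_combinations n" and ct: "strongly_connected (net n t)"
    note B = hop_metric_net_bounds[OF ct assms(1)]
    \<comment> \<open>Since c - b is negative, the largest total distance gives the smallest term;
      the channel count is minimal at the same time.\<close>
    have "(c - b) * real (total_dist n ?s) \<le> (c - b) * real (total_dist n t)"
      by (intro mult_left_mono_neg) (use assms W B(3) in linarith)+
    moreover have "real n - 1 \<le> real (\<Sum>u<n. card (t u))"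
      using card_parcs_le[OF t] B(2) by linarith
    moreover have "real (\<Sum>u<n. card (?s u)) = real n - 1"
      using C assms(1) by (simp add: of_nat_diff)
    ultimately show "real (\<Sum>u<n. card (?s u)) + (c - b) * real (total_dist n ?s)
      \<le> real (\<Sum>u<n. card (t u)) + (c - b) * real (total_dist n t)" by linarith
  qed
  with nd is_path show ?thesis by blast
qed

theorem theorem1:
  fixes n :: nat and b c :: real
  assumes "n \<ge> 1" and "b \<ge> 0" and "c > 0"
  shows "(c > 1/2 + b \<longrightarrow>
           (\<exists>s. attains_social_optimum n b c s \<and> no_double_channel n s \<and>
                is_complete_graph n (network n s))) \<and>
         (b \<le> c \<and> c \<le> 1/2 + b \<longrightarrow>
           (\<exists>s. attains_social_optimum n b c s \<and> no_double_channel n s \<and>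
                is_star_graph n (network n s))) \<and>
         (c < b \<longrightarrow>
           (\<exists>s. attains_social_optimum n b c s \<and> no_double_channel n s \<and>
                is_path_graph n (network n s)))"
proof (intro conjI impI)
  assume "c > 1/2 + b"
  from complete_strategy_optimal[OF assms(1,3) this]
  show "\<exists>s. attains_social_optimum n b c s \<and> no_double_channel n s \<and> is_complete_graph n (network n s)"
    by (rule exI[of _ "complete_strategy n"])
next
  assume "b \<le> c \<and> c \<le> 1/2 + b"
  then have "b \<le> c" "c \<le> 1/2 + b" by simp_all
  from star_strategy_optimal[OF assms(1,3) this]
  show "\<exists>s. attains_social_optimum n b c s \<and> no_double_channel n s \<and> is_star_graph n (network n s)"
    by (rule exI[of _ "star_strategy n"])
next
  assume "c < b"
  from path_strategy_optimal[OF assms(1,3) this]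
  show "\<exists>s. attains_social_optimum n b c s \<and> no_double_channel n s \<and> is_path_graph n (network n s)"
    by (rule exI[of _ "path_strategy n"])
qed

end
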